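(* For all multi-indices $\alpha,\lambda,\kappa\in\mathbb{N}^3$, with $\lambda=(l_1,l_2,l_3)$ and $\kappa=(k_1,k_2,k_3)$, the coefficients $A_{\alpha,\lambda,\kappa}$ have the form $$A_{\alpha,\lambda,\kappa}=\frac{1}{2^{\frac{|\alpha|+3}{2}}}\sum_{\lambda'\preceq\alpha,\ \lambda'\preceq\kappa+\lambda}\frac{1}{\boldsymbol{j}!}\,a_{l'_1k'_1}^{l_1k_1}\,a_{l'_2k'_2}^{l_2k_2}\,a_{l'_3k'_3}^{l_3k_3}\,\gamma_{\kappa'}^{\boldsymbol{j}},$$ where the sum is over $\lambda'=(l'_1,l'_2,l'_3)\in\mathbb{N}^3$, and $\kappa'=(k'_1,k'_2,k'_3)=\kappa+\lambda-\lambda'$, $\boldsymbol{j}=\alpha-\lambda'$. Here, for $d=1,2,3$, $$a_{l'_dk'_d}^{l_dk_d}=2^{-\frac{l'_d+k'_d}{2}}\sum_{s\in\mathbb{Z}}C_{l_d}^{s}\,C_{k_d}^{l'_d-s}(-1)^{k_d-l'_d+s},$$ and, for $\kappa,\boldsymbol{j}\in\mathbb{N}^3$, $$\gamma_{\kappa}^{\boldsymbol{j}}=\int_{\mathbb{R}^3}\int_{S^2}\left[H_{\boldsymbol{j}}\left(\frac{\boldsymbol{g}'}{\sqrt2}\right)-H_{\boldsymbol{j}}\left(\frac{\boldsymbol{g}}{\sqrt2}\right)\right]H_{\kappa}\left(\frac{\boldsymbol{g}}{\sqrt2}\right)B(|\boldsymbol{g}|,\sigma)\,\omega\left(\frac{\boldsymbol{g}}{\sqrt2}\right)\mathrm{d}\sigma\,\mathrm{d}\boldsymbol{g},\qquad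 \boldsymbol{g}'=\frac{1-e}{2}\boldsymbol{g}+\frac{1+e}{2}|\boldsymbol{g}|\sigma.$$
   Context: $\mathbb{N}$ includes $0$. For $\alpha\in\mathbb{N}^3$, $|\alpha|=\alpha_1+\alpha_2+\alpha_3$ and $\alpha!=\alpha_1!\alpha_2!\alpha_3!$; $(i_1,i_2,i_3)\preceq(j_1,j_2,j_3)$ means $i_s\leqslant j_s$ for $s=1,2,3$. The generalized combination number is $C_n^k=\frac{n!}{k!(n-k)!}$ if $0\leqslant k\leqslant n$, and $C_n^k=0$ if $k>n$ or $k<0$. The weight is $\omega(\boldsymbol{v})=(2\pi)^{-3/2}\exp(-|\boldsymbol{v}|^2/2)$ on $\mathbb{R}^3$, and the Hermite polynomials are $$H_\alpha(\boldsymbol{v})=\frac{(-1)^{|\alpha|}}{\omega(\boldsymbol{v})}\frac{\partial^{|\alpha|}}{\partial v_1^{\alpha_1}\partial v_2^{\alpha_2}\partial v_3^{\alpha_3}}\omega(\boldsymbol{v}),\qquad \alpha\in\mathbb{N}^3.$$ The restitution coefficient $e\in[0,1]$ is a constant. $S^2$ is the unit sphere in $\mathbb{R}^3$ with surface measure $\mathrm{d}\sigma$. For velocities $\boldsymbol{v},\boldsymbol{v}_*\in\mathbb{R}^3$ and $\sigma\in S^2$, put $\boldsymbol{g}=\boldsymbol{v}-\boldsymbol{v}_*$ and let $$\boldsymbol{v}'=\frac{\boldsymbol{v}+\boldsymbol{v}_*}{2}+\frac{1-e}{4}(\boldsymbol{v}-\boldsymbol{v}_* )+\frac{1+e}{4}|\boldsymbol{v}-\boldsymbol{v}_*|\sigma.$$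 $B(|\boldsymbol{g}|,\sigma)$ is the collision kernel, a measurable function such that all the integrals defining the coefficients $A_{\alpha,\lambda,\kappa}$ and $\gamma_\kappa^{\boldsymbol{j}}$ converge absolutely. The coefficients are defined by $$A_{\alpha,\lambda,\kappa}=\frac{1}{\alpha!}\int_{\mathbb{R}^3}\int_{\mathbb{R}^3}\int_{S^2}B(|\boldsymbol{g}|,\sigma)\,H_\lambda(\boldsymbol{v})\omega(\boldsymbol{v})\,H_\kappa(\boldsymbol{v}_* )\omega(\boldsymbol{v}_* )\,[H_\alpha(\boldsymbol{v}')-H_\alpha(\boldsymbol{v})]\,\mathrm{d}\sigma\,\mathrm{d}\boldsymbol{v}\,\mathrm{d}\boldsymbol{v}_*.$$ *)

theory Defs
  imports "HOL-Analysis.Analysis"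
begin

definition mi_abs :: "nat ^ 3 \<Rightarrow> nat" where
  "mi_abs \<alpha> = \<alpha> $ 1 + \<alpha> $ 2 + \<alpha> $ 3"

definition mi_fact :: "nat ^ 3 \<Rightarrow> real" where
  "mi_fact \<alpha> = fact (\<alpha> $ 1) * fact (\<alpha> $ 2) * fact (\<alpha> $ 3)"

definition gcomb :: "nat \<Rightarrow> int \<Rightarrow> real" where
  "gcomb n k = (if 0 \<le> k \<and> k \<le> int n then real (n choose nat k) else 0)"

definition \<omega> :: "real ^ 3 \<Rightarrow> real" where
  "\<omega> v = (2 * pi) powr (- 3 / 2) * exp (- (norm v)\<^sup>2 / 2)"

definition partial :: "3 \<Rightarrow> (real ^ 3 \<Rightarrow> real) \<Rightarrow> real ^ 3 \<Rightarrow> real" where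
  "partial i f v = deriv (\<lambda>t. f (v + t *\<^sub>R axis i 1)) 0"

definition mixed_partial :: "nat ^ 3 \<Rightarrow> (real ^ 3 \<Rightarrow> real) \<Rightarrow> real ^ 3 \<Rightarrow> real" where
  "mixed_partial \<alpha> f =
     (partial 1 ^^ (\<alpha> $ 1)) ((partial 2 ^^ (\<alpha> $ 2)) ((partial 3 ^^ (\<alpha> $ 3)) f))"

definition hermite :: "nat ^ 3 \<Rightarrow> real ^ 3 \<Rightarrow> real" where
  "hermite \<alpha> v = (- 1) ^ mi_abs \<alpha> / \<omega> v * mixed_partial \<alpha> \<omega> v"

text \<open>
  Surface measure on the unit sphere: the measure of \<open>A\<close> is 3 times (the dimension times)
  the volume of the cone \<open>{r x | 0 < r < 1, x \<in> A}\<close>; the total mass is \<open>4 \<pi>\<close>, as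
  \<open>emeasure_sphere_measure_space\<close> confirms.
\<close>

definition sphere_measure :: "(real ^ 3) measure" where
  "sphere_measure =
     scale_measure 3
       (distr (restrict_space lborel (ball 0 1 - {0})) (restrict_space borel (sphere 0 1))
         (\<lambda>x. x /\<^sub>R norm x))"

lemma space_sphere_measure [simp]: "space sphere_measure = sphere 0 1"
  by (simp add: sphere_measure_def space_scale_measure space_restrict_space)

lemma sets_sphere_measure [simp, measurable_cong]:
  "sets sphere_measure = sets (restrict_space borel (sphere 0 1))"
  by (simp add: sphere_measure_def)

lemma measurable_normalize_sphere:
  "(\<lambda>x. x /\<^sub>R norm x) \<in>
     restrict_space lborel (ball 0 1 - {0}) \<rightarrow>\<^sub>M restrict_space borel (sphere (0 :: real ^ 3) 1)"
  by (rule measurable_restrict_space3) (auto simp: measurable_lborel2)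

lemma emeasure_sphere_measure:
  assumes "A \<in> sets (restrict_space borel (sphere 0 1))"
  shows "emeasure sphere_measure A =
           3 * emeasure lborel {x \<in> ball 0 1 - {0}. x /\<^sub>R norm x \<in> A}"
proof -
  have "(\<lambda>x. x /\<^sub>R norm x) -` A \<inter> space (restrict_space lborel (ball 0 1 - {0})) =
        {x \<in> ball 0 1 - {0}. x /\<^sub>R norm x \<in> A}"
    by (auto simp: space_restrict_space)
  moreover have "{x \<in> ball 0 1 - {0}. x /\<^sub>R norm x \<in> A} \<subseteq> ball 0 1 - {0}"
    by blast
  ultimately show ?thesis
    using emeasure_distr[OF measurable_normalize_sphere assms]
    by (simp add: sphere_measure_def emeasure_restrict_space)
qed

lemma emeasure_sphere_measure_space:
  "emeasure sphere_measure (sphere 0 1) = ennreal (4 * pi)"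
proof -
  have "sphere 0 1 \<in> sets (restrict_space borel (sphere (0 :: real ^ 3) 1))"
    by (metis sets.top space_restrict_space2 sets_restrict_space_iff space_borel space_restrict_space Int_UNIV_right)
  moreover have "{x \<in> ball 0 1 - {0}. x /\<^sub>R norm x \<in> sphere 0 1} = ball 0 1 - {0 :: real ^ 3}"
    by auto
  moreover have "emeasure lborel (ball 0 1 - {0 :: real ^ 3}) = emeasure lborel (ball (0 :: real ^ 3) 1)"
    by (rule emeasure_Diff_null_set) auto
  moreover have "unit_ball_vol 3 = 4 / 3 * pi"
    by (simp add: unit_ball_vol_3)
  ultimately show ?thesis
    by (simp add: emeasure_sphere_measure emeasure_ball ennreal_mult[symmetric] flip: ennreal_numeral)
qed

definition post_velocity :: "real \<Rightarrow> real ^ 3 \<Rightarrow> real ^ 3 \<Rightarrow> real ^ 3 \<Rightarrow> real ^ 3" where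
  "post_velocity e v w \<sigma> =
     (v + w) /\<^sub>R 2 + ((1 - e) / 4) *\<^sub>R (v - w) + ((1 + e) / 4 * norm (v - w)) *\<^sub>R \<sigma>"

definition post_relative :: "real \<Rightarrow> real ^ 3 \<Rightarrow> real ^ 3 \<Rightarrow> real ^ 3" where
  "post_relative e g \<sigma> = ((1 - e) / 2) *\<^sub>R g + ((1 + e) / 2 * norm g) *\<^sub>R \<sigma>"

definition A_integrand ::
  "real \<Rightarrow> (real \<Rightarrow> real ^ 3 \<Rightarrow> real) \<Rightarrow> nat ^ 3 \<Rightarrow> nat ^ 3 \<Rightarrow> nat ^ 3 \<Rightarrow>
     real ^ 3 \<Rightarrow> real ^ 3 \<Rightarrow> real ^ 3 \<Rightarrow> real" where
  "A_integrand e B \<alpha> l k v w \<sigma> =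
     B (norm (v - w)) \<sigma> * (hermite l v * \<omega> v) * (hermite k w * \<omega> w)
       * (hermite \<alpha> (post_velocity e v w \<sigma>) - hermite \<alpha> v)"

definition A_coeff ::
  "real \<Rightarrow> (real \<Rightarrow> real ^ 3 \<Rightarrow> real) \<Rightarrow> nat ^ 3 \<Rightarrow> nat ^ 3 \<Rightarrow> nat ^ 3 \<Rightarrow> real" where
  "A_coeff e B \<alpha> l k =
     1 / mi_fact \<alpha> *
     (\<integral>w. (\<integral>v. (\<integral>\<sigma>. A_integrand e B \<alpha> l k v w \<sigma> \<partial>sphere_measure) \<partial>lborel) \<partial>lborel)"

text \<open>
  The sum over all integers has finite support, since \<open>gcomb n\<close> vanishes off \<open>{0..n}\<close>; whenever
  the exponent of \<open>- 1\<close> is negative the term is zero.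
\<close>

definition a_coeff :: "nat \<Rightarrow> nat \<Rightarrow> nat \<Rightarrow> nat \<Rightarrow> real" where
  "a_coeff l k l' k' =
     2 powr (- (real l' + real k') / 2) *
     (\<Sum>\<^sub>\<infinity>s\<in>(UNIV :: int set).
        gcomb l s * gcomb k (int l' - s) * (- 1) powi (int k - int l' + s))"

definition gamma_integrand ::
  "real \<Rightarrow> (real \<Rightarrow> real ^ 3 \<Rightarrow> real) \<Rightarrow> nat ^ 3 \<Rightarrow> nat ^ 3 \<Rightarrow> real ^ 3 \<Rightarrow> real ^ 3 \<Rightarrow> real" where
  "gamma_integrand e B k j g \<sigma> =
     (hermite j (post_relative e g \<sigma> /\<^sub>R sqrt 2) - hermite j (g /\<^sub>R sqrt 2))
       * hermite k (g /\<^sub>R sqrt 2) * B (norm g) \<sigma> * \<omega> (g /\<^sub>R sqrt 2)"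

definition gamma_coeff ::
  "real \<Rightarrow> (real \<Rightarrow> real ^ 3 \<Rightarrow> real) \<Rightarrow> nat ^ 3 \<Rightarrow> nat ^ 3 \<Rightarrow> real" where
  "gamma_coeff e B k j =
     (\<integral>g. (\<integral>\<sigma>. gamma_integrand e B k j g \<sigma> \<partial>sphere_measure) \<partial>lborel)"

end

theory Submission
  imports Defs "HOL-Probability.Distributions"
begin

text \<open>
  Put \<open>g = v - w\<close>, \<open>G = g / sqrt 2\<close> and \<open>V = (v + w) / sqrt 2\<close>. The map \<open>(v, w) \<mapsto> (V, G)\<close> is
  orthogonal (in each coordinate it is a rotation by 45 degrees up to a reflection; it is called a
  rotation below), so the Gaussian weight factorises, \<open>\<omega>(v) \<omega>(w) = \<omega>(V) \<omega>(G)\<close>, and the collision acts on \<open>G\<close> only: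
  \<open>v' = (V + G') / sqrt 2\<close> with \<open>G' = g' / sqrt 2\<close>.

  Hermite polynomials behave well under this rotation. The raising operator
  \<open>p \<mapsto> x p - p'\<close> that generates them is minus the derivative conjugated by the Gaussian, so it rotates
  like a derivative. Therefore \<open>H\<^sub>l(v) H\<^sub>k(w)\<close> is a combination of the products \<open>H\<^sub>n(V) H\<^sub>m(G)\<close> with
  \<open>n + m = l + k\<close> (\<open>hermite_rotation\<close>), and its coefficients, those of the binary form
  \<open>(X + Y)\<^sup>l (X - Y)\<^sup>k\<close>, are the numbers \<open>a_coeff\<close>. For \<open>k = 0\<close> this is the addition theorem
  (\<open>hermite_addition\<close>), which expands \<open>H\<^sub>\<alpha>(v') - H\<^sub>\<alpha>(v)\<close> into the products
  \<open>H\<^sub>m(V) (H\<^sub>j(G') - H\<^sub>j(G))\<close> with \<open>m + j = \<alpha>\<close>.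

  The integrand of \<open>A_coeff\<close> is thus a finite sum of terms that separate into a function of \<open>V\<close> and a
  function of \<open>(g, \<sigma>)\<close> (\<open>A_integrand_expansion\<close>). Integrating the latter gives \<open>gamma_coeff\<close>;
  integrating the former against \<open>\<omega>(V)\<close> leaves, by orthogonality (\<open>integral_hermite_hermite\<close>), only the
  terms with \<open>n = m\<close>, and the binomial coefficients combine with \<open>n! / \<alpha>!\<close> to \<open>1 / j!\<close>. The power of 2
  collects the scaling \<open>2 powr (- |\<alpha>| / 2)\<close> of the addition theorem and the Jacobian \<open>2 powr (- 3 / 2)\<close>
  of \<open>g \<mapsto> G\<close>.

  Analytically, \<open>(v, w)\<close> is replaced by \<open>(g, w)\<close>, and the dependence on \<open>w\<close> is only through
  \<open>g / 2 + w = V / sqrt 2\<close>. Each separated term is absolutely integrable as a sheared product of two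
  integrable functions, so Fubini's theorem applies to it (\<open>integral_shear_sum\<close>).
\<close>

section \<open>One-dimensional Hermite polynomials\<close>

text \<open>
  Raising a Hermite polynomial by one degree: differentiating \<open>p \<phi>\<close>, with \<open>\<phi>\<close> the standard
  normal density, gives \<open>- raise p * \<phi>\<close>, so \<open>raise\<close> is minus the derivative conjugated by \<open>\<phi>\<close>.
\<close>

definition raise :: "real poly \<Rightarrow> real poly" where
  "raise p = [:0, 1:] * p - pderiv p"

text \<open>
  The probabilists' Hermite polynomial \<open>He\<^sub>n\<close>, whose multivariate products are the functions
  \<open>hermite\<close>.
\<close>

definition he :: "nat \<Rightarrow> real poly" where
  "he n = (raise ^^ n) 1"

lemma he_0 [simp]: "he 0 = 1"
  and he_Suc [simp]: "he (Suc n) = raise (he n)"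
  by (simp_all add: he_def)

lemma raise_sum: "finite I \<Longrightarrow> raise (\<Sum>i\<in>I. p i) = (\<Sum>i\<in>I. raise (p i))"
  by (simp add: raise_def higher_pderiv_sum[of 1, simplified] sum_distrib_left sum_subtractf)

lemma raise_mult: "raise (p * q) = raise p * q - p * pderiv q"
  by (simp add: raise_def pderiv_mult algebra_simps)

lemma pderiv_raise: "pderiv (raise p) = p + raise (pderiv p)"
  by (simp add: raise_def pderiv_mult pderiv_diff pderiv_pCons algebra_simps)

lemma raise_smult: "raise (smult c p) = smult c (raise p)"
  by (simp add: raise_def pderiv_smult smult_diff_right)

text \<open>
  Differentiation and \<open>raise\<close> satisfy the canonical commutation relation
  (\<open>pderiv_raise\<close>), so differentiation lowers the degree of a Hermite polynomial.
\<close>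

lemma pderiv_he_Suc: "pderiv (he (Suc n)) = smult (real (Suc n)) (he n)"
proof (induction n)
  case 0
  show ?case by (simp add: raise_def pderiv_pCons)
next
  case (Suc n)
  have "pderiv (he (Suc (Suc n))) = he (Suc n) + raise (pderiv (he (Suc n)))"
    using pderiv_raise by simp
  also have "\<dots> = he (Suc n) + smult (real (Suc n)) (he (Suc n))"
    unfolding Suc.IH by (simp add: raise_smult)
  also have "\<dots> = smult (real (Suc (Suc n))) (he (Suc n))"
    by (simp only: of_nat_Suc[of "Suc n"] smult_add_left smult_1_left)
  finally show ?case .
qed

lemma integrable_poly_std_normal [simp]:
  "integrable lborel (\<lambda>x. poly p x * std_normal_density x)"
proof -
  have "integrable lborel (\<lambda>x. \<Sum>i\<le>degree p. coeff p i * (std_normal_density x * x ^ i))"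
    by (intro Bochner_Integration.integrable_sum integrable_mult_right integrable_std_normal_moment)
  then show ?thesis
    by (simp add: poly_altdef sum_distrib_left mult_ac)
qed

lemma std_normal_moment_Suc_Suc:
  "(\<integral>x. std_normal_density x * x ^ Suc (Suc n) \<partial>lborel) =
     real (Suc n) * (\<integral>x. std_normal_density x * x ^ n \<partial>lborel)"
proof (cases "even n")
  case True
  then obtain m where n: "n = 2 * m" by blast
  have *: "(\<integral>x. std_normal_density x * x ^ Suc (Suc n) \<partial>lborel) = fact (2 * Suc m) / (2 ^ Suc m * fact (Suc m))"
    using integral_std_normal_moment_even[of "Suc m"] by (simp add: n)
  have "fact (2 * Suc m) / (2 ^ Suc m * fact (Suc m)) = real (Suc n) * (fact (2 * m) / (2 ^ m * fact m) :: real)"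
    by (simp add: n divide_simps)
  then show ?thesis
    unfolding * by (simp only: n integral_std_normal_moment_even)
next
  case False
  then obtain m where n: "n = 2 * m + 1" by (blast elim: oddE)
  show ?thesis
    using integral_std_normal_moment_odd[of m] integral_std_normal_moment_odd[of "Suc m"]
    by (simp add: n del: power_Suc)
qed

text \<open>
  Up to sign the integrand is the derivative of \<open>p \<phi>\<close>, which decays at infinity. By linearity
  it suffices to take a monomial \<open>p\<close>, where the claim is the two-step recursion of the Gaussian
  moments.
\<close>

lemma integral_raise_std_normal: "(\<integral>x. poly (raise p) x * std_normal_density x \<partial>lborel) = 0"
proof -
  have monom: "(\<integral>x. poly (raise (monom c n)) x * std_normal_density x \<partial>lborel) = 0" for c n
  proof (cases n)
    case 0
    have "(\<integral>x. std_normal_density x * x \<partial>lborel) = 0"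
      using integral_std_normal_moment_odd[of 0] by simp
    then have "(\<integral>x. c * (std_normal_density x * x) \<partial>lborel) = 0"
      by simp
    then show ?thesis
      by (simp add: 0 raise_def monom_0 mult_ac)
  next
    case (Suc m)
    have "(\<integral>x. poly (raise (monom c n)) x * std_normal_density x \<partial>lborel) =
        (\<integral>x. c * (std_normal_density x * x ^ Suc (Suc m))
              - c * real (Suc m) * (std_normal_density x * x ^ m) \<partial>lborel)"
      by (intro Bochner_Integration.integral_cong)
         (simp_all add: Suc raise_def pderiv_monom poly_monom algebra_simps)
    also have "\<dots> = c * (\<integral>x. std_normal_density x * x ^ Suc (Suc m) \<partial>lborel)
        - c * real (Suc m) * (\<integral>x. std_normal_density x * x ^ m \<partial>lborel)"
      by (subst Bochner_Integration.integral_diff)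
         (intro integrable_mult_right integrable_std_normal_moment | simp del: power_Suc)+
    finally show ?thesis
      by (simp add: std_normal_moment_Suc_Suc del: power_Suc)
  qed
  have "raise p = (\<Sum>i\<le>degree p. raise (monom (coeff p i) i))"
    by (simp add: raise_sum[symmetric] poly_as_sum_of_monoms)
  then have "(\<integral>x. poly (raise p) x * std_normal_density x \<partial>lborel) =
     (\<integral>x. (\<Sum>i\<le>degree p. poly (raise (monom (coeff p i) i)) x * std_normal_density x) \<partial>lborel)"
    by (simp add: poly_sum sum_distrib_right)
  also have "\<dots> = 0"
    by (simp add: Bochner_Integration.integral_sum monom)
  finally show ?thesis .
qed

text \<open>
  Integration by parts: \<open>raise\<close> is the adjoint of differentiation in \<open>L\<^sup>2\<close> of the standard normal
  distribution. Orthogonality follows, because each integration by parts lowers both degrees.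
\<close>

lemma integral_raise_mult_std_normal:
  "(\<integral>x. poly (raise p * q) x * std_normal_density x \<partial>lborel) =
     (\<integral>x. poly (p * pderiv q) x * std_normal_density x \<partial>lborel)"
proof -
  have "(\<integral>x. poly (raise (p * q)) x * std_normal_density x \<partial>lborel) =
      (\<integral>x. poly (raise p * q) x * std_normal_density x - poly (p * pderiv q) x * std_normal_density x \<partial>lborel)"
    unfolding raise_mult by (simp add: algebra_simps)
  also have "\<dots> = (\<integral>x. poly (raise p * q) x * std_normal_density x \<partial>lborel)
      - (\<integral>x. poly (p * pderiv q) x * std_normal_density x \<partial>lborel)"
    by (intro Bochner_Integration.integral_diff integrable_poly_std_normal)
  finally show ?thesis
    using integral_raise_std_normal by simp
qed

lemma integral_he_he:
  "(\<integral>x. poly (he m * he n) x * std_normal_density x \<partial>lborel) = (if m = n then fact n else 0)"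
proof (induction m arbitrary: n)
  case 0
  show ?case
  proof (cases n)
    case 0
    then show ?thesis
      using integral_std_normal_moment_even[of 0] by simp
  next
    case (Suc k)
    then show ?thesis
      using integral_raise_std_normal[of "he k"] by simp
  qed
next
  case (Suc m)
  show ?case
  proof (cases n)
    case 0
    then show ?thesis
      using integral_raise_std_normal[of "he m"] by simp
  next
    case (Suc k)
    have "(\<integral>x. poly (he (Suc m) * he n) x * std_normal_density x \<partial>lborel) =
        (\<integral>x. poly (he m * pderiv (he n)) x * std_normal_density x \<partial>lborel)"
      by (simp only: he_Suc integral_raise_mult_std_normal)
    also have "\<dots> = (\<integral>x. real (Suc k) * (poly (he m * he k) x * std_normal_density x) \<partial>lborel)"
      unfolding Suc pderiv_he_Suc by (simp add: mult_ac)
    also have "\<dots> = real (Suc k) * (if m = k then fact k else 0)"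
      using Suc.IH[of k] by (simp del: poly_mult)
    also have "\<dots> = (if Suc m = n then fact n else 0)"
      by (simp add: Suc)
    finally show ?thesis .
  qed
qed

section \<open>Hermite polynomials under an orthogonal change of variables\<close>

text \<open>
  Under the orthogonal substitution \<open>u = (x + y) / sqrt 2\<close>, \<open>v = (x - y) / sqrt 2\<close> the raising operators in \<open>u\<close>
  and \<open>v\<close> are \<open>1 / sqrt 2\<close> times the sum and the difference of those in \<open>x\<close> and \<open>y\<close>. Hence
  \<open>He\<^sub>l(u) He\<^sub>k(v)\<close> is obtained from the binary form \<open>(X + Y)\<^sup>l (X - Y)\<^sup>k\<close> by replacing each monomial
  \<open>X\<^sup>i Y\<^sup>j\<close> with \<open>He\<^sub>i(x) He\<^sub>j(y)\<close>. The polynomial below is this form, dehomogenised at \<open>Y = 1\<close>;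
  its second factor is written \<open>X - 1\<close>, that is \<open>[:- 1, 1:]\<close>.
\<close>

definition rot_poly :: "nat \<Rightarrow> nat \<Rightarrow> real poly" where
  "rot_poly l k = [:1, 1:] ^ l * [:- 1, 1:] ^ k"

lemma rot_poly_Suc:
  "rot_poly (Suc l) k = [:1, 1:] * rot_poly l k" "rot_poly l (Suc k) = [:- 1, 1:] * rot_poly l k"
  by (simp_all only: rot_poly_def power_Suc mult.assoc mult.left_commute[of _ "[:- 1, 1:]"])

lemma degree_rot_poly: "degree (rot_poly l k) \<le> l + k"
proof -
  have "degree (rot_poly l k) \<le> degree ([:1, 1:] ^ l :: real poly) + degree ([:- 1, 1:] ^ k :: real poly)"
    unfolding rot_poly_def by (rule degree_mult_le)
  also have "\<dots> \<le> l + k"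
    by (intro add_mono order.trans[OF degree_power_le]) auto
  finally show ?thesis .
qed

lemma coeff_linear_power: "coeff ([:a, 1:] ^ n) i = real (n choose i) * a ^ (n - i)"
proof (cases "i \<le> n")
  case False
  have "degree ([:a, 1:] ^ n) \<le> n"
    by (rule order.trans[OF degree_power_le]) auto
  then show ?thesis
    using False by (simp add: coeff_eq_0 binomial_eq_0)
qed (simp add: coeff_linear_poly_power)

lemma coeff_rot_poly:
  "coeff (rot_poly l k) n =
     (\<Sum>s\<le>n. if n - s \<le> k then real (l choose s) * real (k choose (n - s)) * (-1) ^ (k - (n - s)) else 0)"
  unfolding rot_poly_def coeff_mult
  by (intro sum.cong refl, unfold coeff_linear_power) (simp add: binomial_eq_0)

text \<open>
  The inner sum in the definition of \<open>a_coeff\<close> is a Cauchy product of two binomial expansions.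
\<close>

lemma a_coeff_eq:
  assumes "l' + k' = l + k"
  shows "a_coeff l k l' k' = coeff (rot_poly l k) l' / sqrt 2 ^ (l + k)"
proof -
  have "(\<Sum>\<^sub>\<infinity>s\<in>(UNIV :: int set). gcomb l s * gcomb k (int l' - s) * (- 1) powi (int k - int l' + s)) =
     (\<Sum>\<^sub>\<infinity>s\<in>int ` {..l'}. gcomb l s * gcomb k (int l' - s) * (- 1) powi (int k - int l' + s))"
  proof (rule infsum_cong_neutral)
    fix s :: int assume "s \<in> UNIV - int ` {..l'}"
    then have "s < 0 \<or> s > int l'"
      by (metis DiffD2 atMost_iff imageI int_nat_eq le_nat_iff linorder_not_less nat_le_iff)
    then show "gcomb l s * gcomb k (int l' - s) * (- 1) powi (int k - int l' + s) = 0"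
      by (auto simp: gcomb_def)
  qed auto
  also have "\<dots> = (\<Sum>s\<le>l'. gcomb l (int s) * gcomb k (int l' - int s) * (- 1) powi (int k - int l' + int s))"
    by (simp add: infsum_finite sum.reindex inj_on_def)
  also have "\<dots> = coeff (rot_poly l k) l'"
    unfolding coeff_rot_poly
  proof (intro sum.cong refl)
    fix s assume "s \<in> {..l'}"
    then have s: "s \<le> l'" by simp
    show "gcomb l (int s) * gcomb k (int l' - int s) * (- 1) powi (int k - int l' + int s) =
       (if l' - s \<le> k then real (l choose s) * real (k choose (l' - s)) * (-1) ^ (k - (l' - s)) else 0)"
    proof (cases "l' - s \<le> k")
      case True
      then have *: "int k - int l' + int s = int (k - (l' - s))" "int l' - int s = int (l' - s)"
        using s by auto
      have "gcomb n (int i) = real (n choose i)" for n i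
        by (simp add: gcomb_def binomial_eq_0)
      then show ?thesis
        unfolding * power_int_of_nat using True by simp
    next
      case False
      then show ?thesis using s by (auto simp: gcomb_def)
    qed
  qed
  finally have "a_coeff l k l' k' = 2 powr (- (real l' + real k') / 2) * coeff (rot_poly l k) l'"
    by (simp add: a_coeff_def)
  also have "2 powr (- (real l' + real k') / 2) = 1 / sqrt 2 ^ (l + k)"
  proof -
    have "- (real l' + real k') / 2 = - (1/2 * real (l + k))"
      using assms by (simp flip: of_nat_add)
    then have "2 powr (- (real l' + real k') / 2) = 1 / (2 powr (1/2 * real (l + k)))"
      by (simp only: powr_minus_divide)
    also have "(2::real) powr (1/2 * real (l + k)) = (2 powr (1/2)) powr real (l + k)"
      by (simp only: powr_powr)
    also have "\<dots> = sqrt 2 ^ (l + k)"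
      by (subst powr_realpow) (simp_all add: powr_half_sqrt)
    finally show ?thesis .
  qed
  finally show ?thesis by simp
qed

text \<open>
  The substitution of Hermite products for monomials in the homogenisation of \<open>q\<close> to degree \<open>N\<close>.
\<close>

definition he_sum :: "nat \<Rightarrow> real poly \<Rightarrow> real \<Rightarrow> real \<Rightarrow> real" where
  "he_sum N q x y = (\<Sum>i\<le>N. coeff q i * (poly (he i) x * poly (he (N - i)) y))"

lemma he_sum_shift:
  "he_sum (Suc N) (pCons c q) x y =
    c * poly (he (Suc N)) y + (\<Sum>i\<le>N. coeff q i * (poly (he (Suc i)) x * poly (he (N - i)) y))"
  unfolding he_sum_def by (subst sum.atMost_Suc_shift) (simp add: coeff_pCons_Suc)

lemma he_sum_Suc:
  assumes "degree q \<le> N"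
  shows "he_sum (Suc N) q x y = (\<Sum>i\<le>N. coeff q i * (poly (he i) x * poly (he (Suc (N - i))) y))"
proof -
  have "coeff q (Suc N) = 0"
    using assms by (simp add: coeff_eq_0)
  then show ?thesis
    unfolding he_sum_def by (simp add: Suc_diff_le del: he_Suc)
qed

lemma poly_raise: "poly (raise p) x = x * poly p x - poly (pderiv p) x"
  by (simp add: raise_def)

text \<open>
  Multiplying the form by \<open>X + \<epsilon> Y\<close> amounts to applying the sum of the raising operator in \<open>x\<close>
  and \<open>\<epsilon>\<close> times the one in \<open>y\<close>. The derivative parts of these operators combine to the
  directional derivative along \<open>(1, \<epsilon>)\<close>; it enters as an arbitrary \<open>D\<close> so that it can be
  computed from another expression for the same function.
\<close>

lemma he_sum_raise:
  assumes "degree q \<le> N"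
    and D: "((\<lambda>t. he_sum N q (x + t) (y + \<epsilon> * t)) has_field_derivative D) (at 0)"
  shows "he_sum (Suc N) ([:\<epsilon>, 1:] * q) x y = (x + \<epsilon> * y) * he_sum N q x y - D"
proof -
  let ?Dx = "\<Sum>i\<le>N. coeff q i * (poly (pderiv (he i)) x * poly (he (N - i)) y)"
  let ?Dy = "\<Sum>i\<le>N. coeff q i * (poly (he i) x * poly (pderiv (he (N - i))) y)"
  have "((\<lambda>t. he_sum N q (x + t) (y + \<epsilon> * t)) has_field_derivative
      (\<Sum>i\<le>N. coeff q i * (poly (pderiv (he i)) x * poly (he (N - i)) y
            + \<epsilon> * (poly (he i) x * poly (pderiv (he (N - i))) y)))) (at 0)"
    unfolding he_sum_def
    by (rule derivative_eq_intros refl poly_DERIV[THEN DERIV_chain2] | simp add: algebra_simps)+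
  then have "D = (\<Sum>i\<le>N. coeff q i * (poly (pderiv (he i)) x * poly (he (N - i)) y
            + \<epsilon> * (poly (he i) x * poly (pderiv (he (N - i))) y)))"
    using D DERIV_unique by blast
  then have D_eq: "D = ?Dx + \<epsilon> * ?Dy"
    by (simp add: sum.distrib sum_distrib_left algebra_simps)
  have "he_sum (Suc N) ([:\<epsilon>, 1:] * q) x y =
      \<epsilon> * he_sum (Suc N) q x y + he_sum (Suc N) (pCons 0 q) x y"
    unfolding he_sum_def by (simp add: sum.distrib sum_distrib_left algebra_simps del: sum.atMost_Suc he_Suc)
  also have "he_sum (Suc N) q x y = y * he_sum N q x y - ?Dy"
    unfolding he_sum_Suc[OF assms(1)]
    by (simp only: he_sum_def poly_raise he_Suc sum_distrib_left sum_subtractf[symmetric])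
       (simp add: algebra_simps)
  also have "he_sum (Suc N) (pCons 0 q) x y = x * he_sum N q x y - ?Dx"
    unfolding he_sum_shift
    by (simp only: he_sum_def poly_raise he_Suc sum_distrib_left sum_subtractf[symmetric])
       (simp add: algebra_simps)
  finally show ?thesis
    by (simp add: D_eq algebra_simps)
qed

text \<open>
  The induction step in either degree. Moving along \<open>(1, 1)\<close> changes \<open>u\<close> at rate \<open>sqrt 2\<close> and fixes
  \<open>v\<close>, so on the left-hand side the directional derivative acts on \<open>P\<close> alone and completes
  \<open>u * P\<close> to \<open>raise P\<close>; the direction \<open>(1, - 1)\<close> does the same for \<open>Q\<close>.
\<close>

lemma rotation_raise:
  assumes deg: "degree q \<le> N"
    and eq: "\<And>x y. poly P ((x + y) / sqrt 2) * poly Q ((x - y) / sqrt 2) = c * he_sum N q x y"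
    and c: "c \<noteq> 0"
  shows "poly (raise P) ((x + y) / sqrt 2) * poly Q ((x - y) / sqrt 2) =
           c / sqrt 2 * he_sum (Suc N) ([:1, 1:] * q) x y" (is ?plus)
    and "poly P ((x + y) / sqrt 2) * poly (raise Q) ((x - y) / sqrt 2) =
           c / sqrt 2 * he_sum (Suc N) ([:- 1, 1:] * q) x y" (is ?minus)
proof -
  define u where "u = (x + y) / sqrt 2"
  define v where "v = (x - y) / sqrt 2"
  have eq': "he_sum N q x y = poly P ((x + y) / sqrt 2) * poly Q ((x - y) / sqrt 2) / c" for x y
    using eq[of x y] c by (simp add: field_simps)
  have two: "2 / sqrt 2 = sqrt (2::real)"
    by (simp add: real_div_sqrt)
  have u: "x + y = sqrt 2 * u" and v: "x - y = sqrt 2 * v"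
    unfolding u_def v_def by (metis nonzero_mult_div_cancel_left real_sqrt_eq_zero_cancel_iff times_divide_eq_right zero_neq_numeral)+
  have hs: "he_sum N q x y = poly P u * poly Q v / c"
    by (simp only: eq' u_def v_def)
  have shift: "(a + 2 * t) / sqrt 2 = a / sqrt 2 + sqrt 2 * t" for a t :: real
  proof -
    have "(2 * t) / sqrt 2 = (2 / sqrt 2) * t"
      by (rule times_divide_eq_left[symmetric])
    then show ?thesis
      by (simp only: two add_divide_distrib)
  qed
  have 1: "((\<lambda>t. he_sum N q (x + t) (y + 1 * t)) has_field_derivative
      sqrt 2 * poly (pderiv P) u * poly Q v / c) (at 0)"
  proof -
    have "(\<lambda>t. he_sum N q (x + t) (y + 1 * t)) = (\<lambda>t. poly P (u + sqrt 2 * t) * poly Q v / c)"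
      unfolding eq' u_def v_def shift[symmetric] by (simp add: algebra_simps)
    then show ?thesis
      using c by (auto intro!: derivative_eq_intros poly_DERIV[THEN DERIV_chain2])
  qed
  show ?plus
    unfolding he_sum_raise[OF deg 1] u_def[symmetric] v_def[symmetric]
    using c by (simp add: hs u poly_raise) (simp add: field_simps)
  have 2: "((\<lambda>t. he_sum N q (x + t) (y + (- 1) * t)) has_field_derivative
      sqrt 2 * poly P u * poly (pderiv Q) v / c) (at 0)"
  proof -
    have "(\<lambda>t. he_sum N q (x + t) (y + (- 1) * t)) = (\<lambda>t. poly P u * poly Q (v + sqrt 2 * t) / c)"
      unfolding eq' u_def v_def shift[symmetric] by (simp add: algebra_simps)
    then show ?thesis
      using c by (auto intro!: derivative_eq_intros poly_DERIV[THEN DERIV_chain2])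
  qed
  show ?minus
    unfolding he_sum_raise[OF deg 2] u_def[symmetric] v_def[symmetric]
    using c by (simp add: hs v poly_raise) (simp add: field_simps)
qed

lemma he_rotation_sum:
  "poly (he l) ((x + y) / sqrt 2) * poly (he k) ((x - y) / sqrt 2) =
     1 / sqrt 2 ^ (l + k) * he_sum (l + k) (rot_poly l k) x y"
proof (induction l arbitrary: x y)
  case 0
  show ?case
  proof (induction k arbitrary: x y)
    case 0
    show ?case by (simp add: he_sum_def rot_poly_def)
  next
    case (Suc k)
    show ?case
      using rotation_raise(2)[OF degree_rot_poly Suc.IH, of x y]
      by (simp add: rot_poly_Suc mult_ac)
  qed
next
  case (Suc l)
  show ?case
    using rotation_raise(1)[OF degree_rot_poly Suc.IH, of x y]
    by (simp add: rot_poly_Suc mult_ac)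
qed

lemma he_rotation:
  "poly (he l) ((x + y) / sqrt 2) * poly (he k) ((x - y) / sqrt 2) =
     (\<Sum>i\<le>l + k. a_coeff l k i (l + k - i) * (poly (he i) x * poly (he (l + k - i)) y))"
  unfolding he_rotation_sum he_sum_def sum_distrib_left
  by (intro sum.cong) (simp_all add: a_coeff_eq)

text \<open>
  The addition theorem is the case \<open>k = 0\<close> of the rotation formula.
\<close>

lemma he_addition:
  "poly (he n) ((x + y) / sqrt 2) =
     (\<Sum>i\<le>n. real (n choose i) / sqrt 2 ^ n * (poly (he i) x * poly (he (n - i)) y))"
proof -
  have "coeff (rot_poly n 0) i = real (n choose i)" for i
    by (simp add: rot_poly_def coeff_linear_power)
  then show ?thesis
    using he_rotation_sum[of n x y 0] by (simp add: he_sum_def sum_distrib_left)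
qed

section \<open>Integrals over Euclidean spaces\<close>

text \<open>
  Lebesgue measure on \<open>real ^ 'n\<close> is the image of a product measure indexed by the standard basis;
  the proof reindexes by the coordinate.
\<close>

lemma
  fixes f :: "'n::finite \<Rightarrow> real \<Rightarrow> real"
  assumes f: "\<And>i. integrable lborel (f i)"
  shows integrable_prod_vec: "integrable lborel (\<lambda>v::real^'n. \<Prod>i\<in>UNIV. f i (v $ i))"
    and integral_prod_vec:
      "(\<integral>v. (\<Prod>i\<in>UNIV. f i ((v :: real^'n) $ i)) \<partial>lborel) = (\<Prod>i\<in>UNIV. integral\<^sup>L lborel (f i))"
proof -
  define e where "e = (\<lambda>i::'n. axis i 1 :: real^'n)"
  have inj: "inj e"
    by (auto simp: e_def inj_def axis_eq_axis)
  have Basis: "Basis = range e"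
    by (auto simp: Basis_vec_def e_def)
  define F where "F b = f (inv e b)" for b
  have F: "integrable lborel (F b)" for b
    using f by (simp add: F_def)
  have prod_eq: "(\<Prod>b\<in>Basis. h (inv e b) b) = (\<Prod>i\<in>UNIV. h i (e i))" for h :: "'n \<Rightarrow> real^'n \<Rightarrow> real"
    unfolding Basis by (subst prod.reindex[OF inj]) (simp add: inv_f_f[OF inj])
  have pull: "(\<Prod>i\<in>UNIV. f i ((\<Sum>b\<in>Basis. x b *\<^sub>R b) $ i)) = (\<Prod>b\<in>Basis. F b (x b))"
    for x :: "real^'n \<Rightarrow> real"
  proof -
    have "(\<Sum>b\<in>Basis. x b *\<^sub>R b) $ i = x (e i)" for i
    proof -
      have "(\<Sum>b\<in>Basis. x b *\<^sub>R b) $ i = (\<Sum>b\<in>Basis. x b *\<^sub>R b) \<bullet> e i"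
        by (simp add: e_def inner_axis)
      also have "\<dots> = x (e i)"
        by (rule inner_sum_left_Basis) (simp add: Basis)
      finally show ?thesis .
    qed
    then show ?thesis
      unfolding F_def using prod_eq[of "\<lambda>i b. f i (x b)"] by simp
  qed
  have [measurable]: "f i \<in> borel_measurable borel" for i
    using borel_measurable_integrable[OF f[of i]] by simp
  have T: "(\<lambda>x. \<Sum>b\<in>Basis. x b *\<^sub>R b) \<in> (\<Pi>\<^sub>M b\<in>(Basis::(real^'n) set). lborel) \<rightarrow>\<^sub>M (borel :: (real^'n) measure)"
    by measurable
  have M: "(\<lambda>v::real^'n. \<Prod>i\<in>UNIV. f i (v $ i)) \<in> borel_measurable borel"
    by measurable
  interpret product_sigma_finite "\<lambda>b::real^'n. lborel :: real measure" ..
  have eq: "(lborel :: (real^'n) measure) =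
      distr (\<Pi>\<^sub>M b\<in>Basis. lborel) borel (\<lambda>x. \<Sum>b\<in>Basis. x b *\<^sub>R b)"
    by (rule lborel_eq)
  show "integrable lborel (\<lambda>v::real^'n. \<Prod>i\<in>UNIV. f i (v $ i))"
    unfolding eq integrable_distr_eq[OF T M] pull
    by (rule product_integrable_prod) (auto intro: F)
  have "(\<integral>v. (\<Prod>i\<in>UNIV. f i ((v :: real^'n) $ i)) \<partial>lborel) =
      (\<integral>x. (\<Prod>b\<in>Basis. F b (x b)) \<partial>(\<Pi>\<^sub>M b\<in>(Basis::(real^'n) set). lborel))"
    unfolding eq integral_distr[OF T M] pull ..
  also have "\<dots> = (\<Prod>b\<in>Basis. integral\<^sup>L lborel (F b))"
    by (rule product_integral_prod) (auto intro: F)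
  also have "\<dots> = (\<Prod>i\<in>UNIV. integral\<^sup>L lborel (f i))"
    unfolding F_def using prod_eq[of "\<lambda>i b. integral\<^sup>L lborel (f i)"] by simp
  finally show "(\<integral>v. (\<Prod>i\<in>UNIV. f i ((v :: real^'n) $ i)) \<partial>lborel) = (\<Prod>i\<in>UNIV. integral\<^sup>L lborel (f i))" .
qed

lemma integral_lborel_translation:
  fixes p :: "'a::euclidean_space \<Rightarrow> real"
  assumes [measurable]: "p \<in> borel_measurable borel"
  shows "(\<integral>x. p (c + x) \<partial>lborel) = (\<integral>x. p x \<partial>lborel)"
proof -
  have "(\<integral>x. p x \<partial>distr lborel borel ((+) c)) = (\<integral>x. p (c + x) \<partial>lborel)"
    by (subst integral_distr) auto
  then show ?thesis
    by (simp add: lborel_distr_plus)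
qed

lemma integrable_lborel_translation:
  fixes p :: "'a::euclidean_space \<Rightarrow> real"
  assumes p: "integrable lborel p"
  shows "integrable lborel (\<lambda>x. p (c + x))"
proof -
  have [measurable]: "p \<in> borel_measurable borel"
    using borel_measurable_integrable[OF p] by simp
  have "integrable (distr lborel borel ((+) c)) p"
    using p by (simp add: lborel_distr_plus)
  then show ?thesis
    by (subst (asm) integrable_distr_eq) auto
qed

lemma
  fixes p :: "'a::euclidean_space \<Rightarrow> real"
  assumes p: "integrable lborel p" and c: "c > 0"
  shows integrable_lborel_scale: "integrable lborel (\<lambda>x. p (c *\<^sub>R x))"
    and integral_lborel_scale: "(\<integral>x. p (c *\<^sub>R x) \<partial>lborel) = (\<integral>x. p x \<partial>lborel) / c ^ DIM('a)"
proof -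
  have [measurable]: "p \<in> borel_measurable borel"
    using borel_measurable_integrable[OF p] by simp
  have eq: "lborel = density (distr lborel borel (\<lambda>x::'a. c *\<^sub>R x)) (\<lambda>_. ennreal (c ^ DIM('a)))"
    using lborel_affine[of c "0::'a"] c by simp
  have "integrable (density (distr lborel borel (\<lambda>x::'a. c *\<^sub>R x)) (\<lambda>_. ennreal (c ^ DIM('a)))) p"
    using p eq by simp
  then have "integrable lborel (\<lambda>x. c ^ DIM('a) * p (c *\<^sub>R x))"
    using c by (simp add: integrable_density integrable_distr_eq)
  then show "integrable lborel (\<lambda>x. p (c *\<^sub>R x))"
    using c by simp
  have "(\<integral>x. p x \<partial>lborel) =
      (\<integral>x. p x \<partial>density (distr lborel borel (\<lambda>x::'a. c *\<^sub>R x)) (\<lambda>_. ennreal (c ^ DIM('a))))"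
    using eq by simp
  also have "\<dots> = c ^ DIM('a) * (\<integral>x. p (c *\<^sub>R x) \<partial>lborel)"
    using c by (simp add: integral_density integral_distr)
  finally show "(\<integral>x. p (c *\<^sub>R x) \<partial>lborel) = (\<integral>x. p x \<partial>lborel) / c ^ DIM('a)"
    using c by (simp add: field_simps)
qed

text \<open>
  The two integrations exchange by Fubini, and for fixed \<open>g\<close> the shift by \<open>r g\<close> leaves the integral over
  \<open>w\<close> unchanged, so the double integral factorises.
\<close>

lemma
  fixes \<Gamma> p :: "'a::euclidean_space \<Rightarrow> real"
  assumes \<Gamma>: "integrable lborel \<Gamma>" and p: "integrable lborel p"
  shows integrable_shear: "integrable (lborel \<Otimes>\<^sub>M lborel) (\<lambda>(g, w). \<Gamma> g * p (r *\<^sub>R g + w))"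
    and integral_shear: "(\<integral>w. (\<integral>g. \<Gamma> g * p (r *\<^sub>R g + w) \<partial>lborel) \<partial>lborel) =
           (\<integral>g. \<Gamma> g \<partial>lborel) * (\<integral>w. p w \<partial>lborel)"
proof -
  have [measurable]: "p \<in> borel_measurable borel" "\<Gamma> \<in> borel_measurable borel"
    using borel_measurable_integrable[OF p] borel_measurable_integrable[OF \<Gamma>] by simp_all
  show int: "integrable (lborel \<Otimes>\<^sub>M lborel) (\<lambda>(g, w). \<Gamma> g * p (r *\<^sub>R g + w))"
  proof (rule lborel_pair.Fubini_integrable)
    show "(\<lambda>(g, w). \<Gamma> g * p (r *\<^sub>R g + w)) \<in> borel_measurable (lborel \<Otimes>\<^sub>M lborel)"
      by measurable
    have "(\<integral>w. norm (\<Gamma> g * p (r *\<^sub>R g + w)) \<partial>lborel) = norm (\<Gamma> g) * (\<integral>w. norm (p w) \<partial>lborel)" for g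
      using integral_lborel_translation[of "\<lambda>x. norm (p x)" "r *\<^sub>R g"]
      by (simp add: norm_mult abs_mult)
    then show "integrable lborel (\<lambda>g. \<integral>w. norm (case (g, w) of (g, w) \<Rightarrow> \<Gamma> g * p (r *\<^sub>R g + w)) \<partial>lborel)"
      using \<Gamma> by simp
    show "AE g in lborel. integrable lborel (\<lambda>w. case (g, w) of (g, w) \<Rightarrow> \<Gamma> g * p (r *\<^sub>R g + w))"
      by (simp add: integrable_lborel_translation[OF p])
  qed
  have "(\<integral>w. (\<integral>g. \<Gamma> g * p (r *\<^sub>R g + w) \<partial>lborel) \<partial>lborel) =
      (\<integral>g. (\<integral>w. \<Gamma> g * p (r *\<^sub>R g + w) \<partial>lborel) \<partial>lborel)"
    using lborel_pair.integral_snd[OF int] lborel_pair.integral_fst[OF int] by simp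
  also have "\<dots> = (\<integral>g. \<Gamma> g * (\<integral>w. p w \<partial>lborel) \<partial>lborel)"
    by (simp add: integral_lborel_translation)
  also have "\<dots> = (\<integral>g. \<Gamma> g \<partial>lborel) * (\<integral>w. p w \<partial>lborel)"
    by simp
  finally show "(\<integral>w. (\<integral>g. \<Gamma> g * p (r *\<^sub>R g + w) \<partial>lborel) \<partial>lborel) =
           (\<integral>g. \<Gamma> g \<partial>lborel) * (\<integral>w. p w \<partial>lborel)" .
qed

lemma AE_lborel_translation:
  fixes P :: "'a::euclidean_space \<Rightarrow> bool"
  assumes "AE x in lborel. P x"
  shows "AE x in lborel. P (x - c)"
proof -
  obtain N where sub: "{x \<in> space lborel. \<not> P x} \<subseteq> N" and "emeasure lborel N = 0" "N \<in> sets lborel"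
    using assms by (rule AE_E)
  then have N: "N \<in> null_sets lborel" and [measurable]: "N \<in> sets borel"
    by (simp_all add: null_sets_def)
  have "AE x in lborel. x \<notin> N"
    using N by (rule AE_not_in)
  then have "AE x in distr lborel borel ((+) (- c)). x \<notin> N"
    unfolding lborel_distr_plus[of "- c"] .
  then have "AE x in lborel. - c + x \<notin> N"
    by (subst (asm) AE_distr_iff) auto
  then show ?thesis
    by eventually_elim (use sub in auto)
qed

lemma integral_shear_sum:
  fixes \<Gamma> p :: "'i \<Rightarrow> 'a::euclidean_space \<Rightarrow> real"
  assumes "finite I" and \<Gamma>: "\<And>i. i \<in> I \<Longrightarrow> integrable lborel (\<Gamma> i)"
    and p: "\<And>i. i \<in> I \<Longrightarrow> integrable lborel (p i)"
  shows "(\<integral>w. (\<integral>g. (\<Sum>i\<in>I. \<Gamma> i g * p i (r *\<^sub>R g + w)) \<partial>lborel) \<partial>lborel) =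
           (\<Sum>i\<in>I. (\<integral>g. \<Gamma> i g \<partial>lborel) * (\<integral>w. p i w \<partial>lborel))"
proof -
  have int: "integrable (lborel \<Otimes>\<^sub>M lborel) (\<lambda>(g, w). \<Gamma> i g * p i (r *\<^sub>R g + w))" if "i \<in> I" for i
    using integrable_shear[OF \<Gamma>[OF that] p[OF that]] .
  have sum: "integrable (lborel \<Otimes>\<^sub>M lborel) (\<lambda>(g, w). \<Sum>i\<in>I. \<Gamma> i g * p i (r *\<^sub>R g + w))"
    using Bochner_Integration.integrable_sum[OF int, of I "\<lambda>i. i"] by (simp add: case_prod_unfold)
  have "(\<integral>w. (\<integral>g. (\<Sum>i\<in>I. \<Gamma> i g * p i (r *\<^sub>R g + w)) \<partial>lborel) \<partial>lborel) =
      integral\<^sup>L (lborel \<Otimes>\<^sub>M lborel) (\<lambda>(g, w). \<Sum>i\<in>I. \<Gamma> i g * p i (r *\<^sub>R g + w))"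
    by (rule lborel_pair.integral_snd[OF sum])
  also have "\<dots> = (\<Sum>i\<in>I. integral\<^sup>L (lborel \<Otimes>\<^sub>M lborel) (\<lambda>(g, w). \<Gamma> i g * p i (r *\<^sub>R g + w)))"
    using Bochner_Integration.integral_sum[OF int, of I "\<lambda>i. i"] by (simp add: case_prod_unfold)
  also have "\<dots> = (\<Sum>i\<in>I. (\<integral>g. \<Gamma> i g \<partial>lborel) * (\<integral>w. p i w \<partial>lborel))"
  proof (intro sum.cong refl)
    fix i assume i: "i \<in> I"
    show "integral\<^sup>L (lborel \<Otimes>\<^sub>M lborel) (\<lambda>(g, w). \<Gamma> i g * p i (r *\<^sub>R g + w)) =
        (\<integral>g. \<Gamma> i g \<partial>lborel) * (\<integral>w. p i w \<partial>lborel)"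
      using lborel_pair.integral_snd[OF int[OF i]] integral_shear[OF \<Gamma>[OF i] p[OF i], of r] by simp
  qed
  finally show ?thesis .
qed

section \<open>Hermite functions on three-dimensional space\<close>

lemma prod_UNIV_3: "(\<Prod>d\<in>(UNIV :: 3 set). f d) = f 1 * f 2 * (f 3 :: 'a::comm_monoid_mult)"
  unfolding UNIV_3 by (simp add: mult.assoc)

lemma \<omega>_eq_prod: "\<omega> v = (\<Prod>d\<in>UNIV. std_normal_density (v $ d))"
proof -
  have "(norm v)\<^sup>2 = (v $ 1)\<^sup>2 + (v $ 2)\<^sup>2 + (v $ 3)\<^sup>2"
    by (simp add: norm_vec_def L2_set_def sum_3)
  then have "exp (- (norm v)\<^sup>2 / 2) = exp (- (v $ 1)\<^sup>2 / 2) * exp (- (v $ 2)\<^sup>2 / 2) * exp (- (v $ 3)\<^sup>2 / 2)"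
    by (simp add: exp_add[symmetric] add_divide_distrib diff_divide_distrib)
  moreover have "(2 * pi) powr (- 3 / 2) = (1 / sqrt (2 * pi)) ^ 3"
  proof -
    have "(2 * pi) powr (- 3 / 2) = ((2 * pi) powr (- (1 / 2))) powr real 3"
      by (simp add: powr_powr)
    also have "(2 * pi) powr (- (1 / 2)) = 1 / sqrt (2 * pi)"
      by (simp only: powr_minus_divide) (simp add: powr_half_sqrt)
    also have "(1 / sqrt (2 * pi)) powr real 3 = (1 / sqrt (2 * pi)) ^ 3"
      by (rule powr_realpow) simp
    finally show ?thesis .
  qed
  ultimately show ?thesis
    unfolding \<omega>_def by (simp add: prod_UNIV_3 std_normal_density_def power3_eq_cube mult_ac)
qed

lemma \<omega>_pos: "\<omega> v > 0"
  by (simp add: \<omega>_def)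

lemma DERIV_poly_std_normal:
  "((\<lambda>x. poly p x * std_normal_density x) has_field_derivative
     - (poly (raise p) x * std_normal_density x)) (at x)"
proof -
  have "(std_normal_density has_field_derivative - (x * std_normal_density x)) (at x)"
    unfolding std_normal_density_def
    by (rule derivative_eq_intros refl | simp add: power2_eq_square)+
  from DERIV_mult[OF poly_DERIV this] show ?thesis
    by (simp add: poly_raise algebra_simps)
qed

text \<open>
  The mixed partial derivatives of \<open>\<omega>\<close>, as products over the coordinates. The index is a function
  and not a vector, so that a differentiation is a function update.
\<close>

definition hermite_gauss :: "(3 \<Rightarrow> nat) \<Rightarrow> real ^ 3 \<Rightarrow> real" where
  "hermite_gauss n v = (\<Prod>d\<in>UNIV. (- 1) ^ n d * (poly (he (n d)) (v $ d) * std_normal_density (v $ d)))"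

lemma partial_hermite_gauss: "partial i (hermite_gauss n) = hermite_gauss (n(i := Suc (n i)))"
proof
  fix v :: "real ^ 3"
  define R where "R = (\<Prod>d\<in>UNIV - {i}. (- 1) ^ n d * (poly (he (n d)) (v $ d) * std_normal_density (v $ d)))"
  have split: "(\<Prod>d\<in>UNIV. f d) = f i * (\<Prod>d\<in>UNIV - {i}. f d)" for f :: "3 \<Rightarrow> real"
    by (rule prod.remove) auto
  have line: "hermite_gauss n (v + t *\<^sub>R axis i 1) =
      (- 1) ^ n i * (poly (he (n i)) (t + v $ i) * std_normal_density (t + v $ i)) * R" for t
    unfolding hermite_gauss_def split R_def by (simp add: axis_def add.commute)
  have "((\<lambda>t. poly (he (n i)) (t + v $ i) * std_normal_density (t + v $ i)) has_field_derivative
      - (poly (raise (he (n i))) (v $ i) * std_normal_density (v $ i))) (at 0)"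
    using DERIV_poly_std_normal[of "he (n i)" "0 + v $ i"] unfolding DERIV_shift by simp
  then have "((\<lambda>t. hermite_gauss n (v + t *\<^sub>R axis i 1)) has_field_derivative
      (- 1) ^ n i * (- (poly (raise (he (n i))) (v $ i) * std_normal_density (v $ i))) * R) (at 0)"
    unfolding line by (intro DERIV_cmult DERIV_cmult_right)
  then have "partial i (hermite_gauss n) v =
      (- 1) ^ n i * (- (poly (raise (he (n i))) (v $ i) * std_normal_density (v $ i))) * R"
    unfolding partial_def by (rule DERIV_imp_deriv)
  also have "\<dots> = hermite_gauss (n(i := Suc (n i))) v"
    unfolding hermite_gauss_def split R_def by simp
  finally show "partial i (hermite_gauss n) v = hermite_gauss (n(i := Suc (n i))) v" .
qed

lemma partial_power_hermite_gauss:
  "(partial i ^^ m) (hermite_gauss n) = hermite_gauss (n(i := n i + m))"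
proof (induction m)
  case (Suc m)
  have "(partial i ^^ Suc m) (hermite_gauss n) = partial i (hermite_gauss (n(i := n i + m)))"
    by (simp only: funpow.simps o_apply Suc.IH)
  then show ?case
    by (simp only: partial_hermite_gauss fun_upd_upd fun_upd_same add_Suc_right)
qed (simp only: funpow.simps id_apply add_0_right fun_upd_triv)

lemma hermite_eq_prod: "hermite \<alpha> v = (\<Prod>d\<in>UNIV. poly (he (\<alpha> $ d)) (v $ d))"
proof -
  have gauss: "\<omega> = hermite_gauss (\<lambda>_. 0)"
    by (simp add: fun_eq_iff \<omega>_eq_prod hermite_gauss_def)
  have "mixed_partial \<alpha> \<omega> = hermite_gauss ((\<lambda>_. 0)(3 := \<alpha> $ 3, 2 := \<alpha> $ 2, 1 := \<alpha> $ 1))"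
    unfolding mixed_partial_def gauss partial_power_hermite_gauss by simp
  also have "(\<lambda>_. 0)(3 := \<alpha> $ 3, 2 := \<alpha> $ 2, 1 := \<alpha> $ 1) = (\<lambda>d. \<alpha> $ d)"
    by (auto simp: fun_eq_iff forall_3)
  finally have mixed: "mixed_partial \<alpha> \<omega> = hermite_gauss (\<lambda>d. \<alpha> $ d)" .
  have "mixed_partial \<alpha> \<omega> v = (- 1) ^ mi_abs \<alpha> * (\<Prod>d\<in>UNIV. poly (he (\<alpha> $ d)) (v $ d)) * \<omega> v"
    unfolding mixed by (simp add: hermite_gauss_def \<omega>_eq_prod prod_UNIV_3 mi_abs_def power_add mult_ac)
  then show ?thesis
    using \<omega>_pos[of v] by (simp add: hermite_def flip: power_mult_distrib)
qed

lemma mi_fact_eq_prod: "mi_fact \<alpha> = (\<Prod>d\<in>UNIV. fact (\<alpha> $ d))"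
  by (simp add: mi_fact_def prod_UNIV_3)

lemma mi_abs_eq_sum: "mi_abs \<alpha> = (\<Sum>d\<in>UNIV. \<alpha> $ d)"
  by (simp add: mi_abs_def sum_3)

lemma
  shows integrable_hermite_hermite: "integrable lborel (\<lambda>v. hermite \<alpha> v * hermite \<beta> v * \<omega> v)"
    and integral_hermite_hermite:
      "(\<integral>v. hermite \<alpha> v * hermite \<beta> v * \<omega> v \<partial>lborel) = (if \<alpha> = \<beta> then mi_fact \<alpha> else 0)"
proof -
  have eq: "hermite \<alpha> v * hermite \<beta> v * \<omega> v =
      (\<Prod>d\<in>UNIV. poly (he (\<alpha> $ d) * he (\<beta> $ d)) (v $ d) * std_normal_density (v $ d))" for v
    by (simp add: hermite_eq_prod \<omega>_eq_prod prod.distrib)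
  show "integrable lborel (\<lambda>v. hermite \<alpha> v * hermite \<beta> v * \<omega> v)"
    unfolding eq by (intro integrable_prod_vec integrable_poly_std_normal)
  have "(\<integral>v. hermite \<alpha> v * hermite \<beta> v * \<omega> v \<partial>lborel) =
      (\<Prod>d\<in>UNIV. (\<integral>x. poly (he (\<alpha> $ d) * he (\<beta> $ d)) x * std_normal_density x \<partial>lborel))"
    unfolding eq by (intro integral_prod_vec integrable_poly_std_normal)
  also have "\<dots> = (\<Prod>d\<in>UNIV. if \<alpha> $ d = \<beta> $ d then fact (\<beta> $ d) else 0)"
    unfolding integral_he_he ..
  also have "\<dots> = (if \<alpha> = \<beta> then mi_fact \<alpha> else 0)"
  proof (cases "\<alpha> = \<beta>")
    case True
    then show ?thesis by (simp add: mi_fact_eq_prod)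
  next
    case False
    then obtain d where "\<alpha> $ d \<noteq> \<beta> $ d"
      by (auto simp: vec_eq_iff)
    then have "(\<Prod>d\<in>UNIV. if \<alpha> $ d = \<beta> $ d then fact (\<beta> $ d) else (0::real)) = 0"
      by (intro prod_zero) auto
    then show ?thesis
      using False by simp
  qed
  finally show "(\<integral>v. hermite \<alpha> v * hermite \<beta> v * \<omega> v \<partial>lborel) = (if \<alpha> = \<beta> then mi_fact \<alpha> else 0)" .
qed

lemma
  fixes N :: "nat ^ 'n"
  shows finite_vec_le: "finite {n. n \<le> N}"
    and prod_sum_vec: "(\<Prod>d\<in>UNIV. \<Sum>i\<le>N $ d. f d i) =
      (\<Sum>n | n \<le> N. \<Prod>d\<in>UNIV. f d (n $ d) :: real)"
proof -
  have bij: "bij_betw vec_lambda (PiE UNIV (\<lambda>d. {..N $ d})) {n. n \<le> N}"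
    by (rule bij_betw_byWitness[where f' = vec_nth]) (auto simp: less_eq_vec_def PiE_iff)
  moreover have "finite (PiE UNIV (\<lambda>d. {..N $ d}))"
    by (intro finite_PiE) auto
  ultimately show "finite {n. n \<le> N}"
    using bij_betw_finite by blast
  have "(\<Prod>d\<in>UNIV. \<Sum>i\<le>N $ d. f d i) = (\<Sum>g\<in>PiE UNIV (\<lambda>d. {..N $ d}). \<Prod>d\<in>UNIV. f d (g d))"
    by (rule prod_sum_PiE) auto
  also have "\<dots> = (\<Sum>n | n \<le> N. \<Prod>d\<in>UNIV. f d (n $ d))"
    using sum.reindex_bij_betw[OF bij, of "\<lambda>n. \<Prod>d\<in>UNIV. f d (n $ d)"] by simp
  finally show "(\<Prod>d\<in>UNIV. \<Sum>i\<le>N $ d. f d i) = (\<Sum>n | n \<le> N. \<Prod>d\<in>UNIV. f d (n $ d))" .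
qed

text \<open>
  The coordinatewise rotation formula, with the product of the three sums expanded into one sum
  over multi-indices.
\<close>

lemma hermite_rotation:
  "hermite l ((V + G) /\<^sub>R sqrt 2) * hermite k ((V - G) /\<^sub>R sqrt 2) =
     (\<Sum>n | n \<le> k + l. (\<Prod>d\<in>UNIV. a_coeff (l $ d) (k $ d) (n $ d) ((k + l - n) $ d))
        * (hermite n V * hermite (k + l - n) G))"
proof -
  have "hermite l ((V + G) /\<^sub>R sqrt 2) * hermite k ((V - G) /\<^sub>R sqrt 2) =
     (\<Prod>d\<in>UNIV. poly (he (l $ d)) ((V $ d + G $ d) / sqrt 2) * poly (he (k $ d)) ((V $ d - G $ d) / sqrt 2))"
    by (simp add: hermite_eq_prod prod.distrib divide_inverse mult.commute)
  also have "\<dots> = (\<Prod>d\<in>UNIV. \<Sum>i\<le>(k + l) $ d. a_coeff (l $ d) (k $ d) i ((k + l) $ d - i)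
       * (poly (he i) (V $ d) * poly (he ((k + l) $ d - i)) (G $ d)))"
    unfolding he_rotation by (simp add: add.commute)
  finally show ?thesis
    unfolding prod_sum_vec by (simp add: hermite_eq_prod prod.distrib)
qed

lemma hermite_addition:
  "hermite \<alpha> ((V + G) /\<^sub>R sqrt 2) =
     (\<Sum>n | n \<le> \<alpha>. (\<Prod>d\<in>UNIV. real (\<alpha> $ d choose n $ d)) / sqrt 2 ^ mi_abs \<alpha>
        * (hermite n V * hermite (\<alpha> - n) G))"
proof -
  have "hermite \<alpha> ((V + G) /\<^sub>R sqrt 2) = (\<Prod>d\<in>UNIV. poly (he (\<alpha> $ d)) ((V $ d + G $ d) / sqrt 2))"
    by (simp add: hermite_eq_prod divide_inverse mult.commute)
  also have "\<dots> = (\<Prod>d\<in>UNIV. \<Sum>i\<le>\<alpha> $ d. real (\<alpha> $ d choose i) / sqrt 2 ^ (\<alpha> $ d)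
       * (poly (he i) (V $ d) * poly (he (\<alpha> $ d - i)) (G $ d)))"
    unfolding he_addition ..
  finally show ?thesis
    unfolding prod_sum_vec by (simp add: hermite_eq_prod prod.distrib prod_dividef power_sum mi_abs_eq_sum)
qed

lemma \<omega>_rotation: "\<omega> ((V + G) /\<^sub>R sqrt 2) * \<omega> ((V - G) /\<^sub>R sqrt 2) = \<omega> V * \<omega> G"
proof -
  have half: "(norm (x /\<^sub>R sqrt 2))\<^sup>2 = (norm x)\<^sup>2 / 2" for x :: "real ^ 3"
    by (simp add: power_mult_distrib power_divide field_simps)
  have "(norm ((V + G) /\<^sub>R sqrt 2))\<^sup>2 + (norm ((V - G) /\<^sub>R sqrt 2))\<^sup>2 = (norm V)\<^sup>2 + (norm G)\<^sup>2"
    unfolding half by (simp add: power2_norm_eq_inner inner_simps inner_commute) (simp add: field_simps)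
  then have *: "- (norm ((V + G) /\<^sub>R sqrt 2))\<^sup>2 / 2 + - (norm ((V - G) /\<^sub>R sqrt 2))\<^sup>2 / 2
      = - (norm V)\<^sup>2 / 2 + - (norm G)\<^sup>2 / 2"
    by (simp only: minus_divide_left[symmetric] minus_add_distrib[symmetric] add_divide_distrib[symmetric])
  show ?thesis
    using arg_cong[OF *, of exp] unfolding \<omega>_def exp_add by simp
qed

section \<open>The collision integral\<close>

lemma finite_measure_sphere_measure: "finite_measure sphere_measure"
  by (rule finite_measureI) (simp add: emeasure_sphere_measure_space)

interpretation sphere_measure: finite_measure sphere_measure
  by (rule finite_measure_sphere_measure)

interpretation velocity_sphere: pair_sigma_finite "lborel :: (real ^ 3) measure" sphere_measure ..

definition rotation_coeff :: "nat ^ 3 \<Rightarrow> nat ^ 3 \<Rightarrow> nat ^ 3 \<Rightarrow> real" where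
  "rotation_coeff l k n = (\<Prod>d\<in>UNIV. a_coeff (l $ d) (k $ d) (n $ d) ((k + l - n) $ d))"

definition mi_choose :: "nat ^ 3 \<Rightarrow> nat ^ 3 \<Rightarrow> real" where
  "mi_choose \<alpha> m = (\<Prod>d\<in>UNIV. real (\<alpha> $ d choose m $ d))"

lemma mi_choose_mi_fact:
  assumes "m \<le> \<alpha>"
  shows "mi_choose \<alpha> m * mi_fact m * mi_fact (\<alpha> - m) = mi_fact \<alpha>"
proof -
  have "real (\<alpha> $ d choose m $ d) * fact (m $ d) * fact ((\<alpha> - m) $ d) = fact (\<alpha> $ d)" for d
    using assms by (simp add: less_eq_vec_def binomial_fact)
  then show ?thesis
    by (simp only: mi_choose_def mi_fact_eq_prod prod.distrib[symmetric])
qed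

text \<open>
  With \<open>v = w + g\<close>, the rescaled centre of mass \<open>V\<close> and the rescaled relative velocity
  \<open>G = g / sqrt 2\<close> arise from \<open>(v, w)\<close> by a rotation, and a collision keeps \<open>V\<close> and replaces \<open>G\<close> by
  \<open>G' = g' / sqrt 2\<close>. Expanding the two incoming factors by \<open>hermite_rotation\<close> and \<open>H\<^sub>\<alpha>(v') - H\<^sub>\<alpha>(v)\<close>
  by \<open>hermite_addition\<close> separates \<open>V\<close> from \<open>(g, \<sigma>)\<close>.
\<close>

lemma A_integrand_expansion:
  fixes g w :: "real ^ 3"
  defines "V \<equiv> sqrt 2 *\<^sub>R ((1 / 2) *\<^sub>R g + w)"
  shows "A_integrand e B \<alpha> l k (w + g) w \<sigma> =
    (\<Sum>(n, m)\<in>{n. n \<le> k + l} \<times> {m. m \<le> \<alpha>}.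
       rotation_coeff l k n * mi_choose \<alpha> m / sqrt 2 ^ mi_abs \<alpha>
       * gamma_integrand e B (k + l - n) (\<alpha> - m) g \<sigma> * (hermite n V * hermite m V * \<omega> V))"
proof -
  define G where "G = g /\<^sub>R sqrt 2"
  define G' where "G' = post_relative e g \<sigma> /\<^sub>R sqrt 2"
  have half: "x /\<^sub>R sqrt 2 /\<^sub>R sqrt 2 = (1 / 2) *\<^sub>R x" for x :: "real ^ 3"
    by (simp add: field_simps flip: real_sqrt_mult)
  have V: "V /\<^sub>R sqrt 2 = (1 / 2) *\<^sub>R g + w"
    by (simp add: V_def)
  have v: "w + g = (V + G) /\<^sub>R sqrt 2"
    unfolding scaleR_add_right V G_def half by (simp add: vec_eq_iff field_simps)
  have w: "w = (V - G) /\<^sub>R sqrt 2"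
    unfolding scaleR_diff_right V G_def half by simp
  have v': "post_velocity e (w + g) w \<sigma> = (V + G') /\<^sub>R sqrt 2"
    unfolding scaleR_add_right V G'_def half
    by (simp add: post_velocity_def post_relative_def vec_eq_iff field_simps)
  have lk: "hermite l (w + g) * hermite k w =
      (\<Sum>n | n \<le> k + l. rotation_coeff l k n * (hermite n V * hermite (k + l - n) G))"
    unfolding rotation_coeff_def hermite_rotation[symmetric] using v w by metis
  have \<omega>: "\<omega> (w + g) * \<omega> w = \<omega> V * \<omega> G"
    using \<omega>_rotation[of V G] by (simp only: v[symmetric] w[symmetric])
  have "hermite \<alpha> (post_velocity e (w + g) w \<sigma>) - hermite \<alpha> (w + g) =
      hermite \<alpha> ((V + G') /\<^sub>R sqrt 2) - hermite \<alpha> ((V + G) /\<^sub>R sqrt 2)"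
    by (simp only: v' v[symmetric])
  also have "\<dots> = (\<Sum>m | m \<le> \<alpha>. mi_choose \<alpha> m / sqrt 2 ^ mi_abs \<alpha>
         * (hermite m V * (hermite (\<alpha> - m) G' - hermite (\<alpha> - m) G)))"
    unfolding hermite_addition mi_choose_def[symmetric] sum_subtractf[symmetric]
    by (simp only: right_diff_distrib)
  finally have \<alpha>: "hermite \<alpha> (post_velocity e (w + g) w \<sigma>) - hermite \<alpha> (w + g) = \<dots>" .
  have "A_integrand e B \<alpha> l k (w + g) w \<sigma> =
      (hermite l (w + g) * hermite k w)
       * (hermite \<alpha> (post_velocity e (w + g) w \<sigma>) - hermite \<alpha> (w + g))
       * (B (norm g) \<sigma> * (\<omega> (w + g) * \<omega> w))"
    by (simp add: A_integrand_def mult_ac)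
  also have "\<dots> = (\<Sum>(n, m)\<in>{n. n \<le> k + l} \<times> {m. m \<le> \<alpha>}.
      rotation_coeff l k n * (hermite n V * hermite (k + l - n) G)
      * (mi_choose \<alpha> m / sqrt 2 ^ mi_abs \<alpha>
         * (hermite m V * (hermite (\<alpha> - m) G' - hermite (\<alpha> - m) G)))
      * (B (norm g) \<sigma> * (\<omega> V * \<omega> G)))"
    unfolding lk \<alpha> \<omega> sum_product sum.cartesian_product
    by (simp only: sum_distrib_right case_prod_unfold)
  also have "\<dots> = (\<Sum>(n, m)\<in>{n. n \<le> k + l} \<times> {m. m \<le> \<alpha>}.
       rotation_coeff l k n * mi_choose \<alpha> m / sqrt 2 ^ mi_abs \<alpha>
       * gamma_integrand e B (k + l - n) (\<alpha> - m) g \<sigma> * (hermite n V * hermite m V * \<omega> V))"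
    by (intro sum.cong) (auto simp: gamma_integrand_def G_def[symmetric] G'_def[symmetric] mult_ac)
  finally show ?thesis .
qed

theorem theorem2:
  fixes e :: real and B :: "real \<Rightarrow> real ^ 3 \<Rightarrow> real" and \<alpha> l k :: "nat ^ 3"
  assumes e: "0 \<le> e" "e \<le> 1"
    and B_measurable:
      "(\<lambda>(r, \<sigma>). B r \<sigma>) \<in> borel_measurable (restrict_space borel {0..} \<Otimes>\<^sub>M sphere_measure)"
    and A_integrable:
      "\<And>\<alpha> l k :: nat ^ 3. integrable (lborel \<Otimes>\<^sub>M lborel \<Otimes>\<^sub>M sphere_measure)
         (\<lambda>(w, v, \<sigma>). A_integrand e B \<alpha> l k v w \<sigma>)"
    and gamma_integrable:
      "\<And>k j :: nat ^ 3. integrable (lborel \<Otimes>\<^sub>M sphere_measure)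
         (\<lambda>(g, \<sigma>). gamma_integrand e B k j g \<sigma>)"
  shows "A_coeff e B \<alpha> l k =
    1 / 2 powr ((real (mi_abs \<alpha>) + 3) / 2) *
    (\<Sum>l' | l' \<le> \<alpha> \<and> l' \<le> k + l.
       let k' = k + l - l'; j = \<alpha> - l' in
       1 / mi_fact j
         * a_coeff (l $ 1) (k $ 1) (l' $ 1) (k' $ 1)
         * a_coeff (l $ 2) (k $ 2) (l' $ 2) (k' $ 2)
         * a_coeff (l $ 3) (k $ 3) (l' $ 3) (k' $ 3)
         * gamma_coeff e B k' j)"
proof -
  let ?I = "{n. n \<le> k + l} \<times> {m. m \<le> \<alpha>}"
  have fin: "finite ?I"
    by (intro finite_cartesian_product finite_vec_le)
  define c where "c n m = rotation_coeff l k n * mi_choose \<alpha> m / sqrt 2 ^ mi_abs \<alpha>" for n m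
  define \<Gamma> where "\<Gamma> = (\<lambda>(n, m) g. c n m * (\<integral>\<sigma>. gamma_integrand e B (k + l - n) (\<alpha> - m) g \<sigma> \<partial>sphere_measure))"
  define P where "P = (\<lambda>(n, m) x. hermite n (sqrt 2 *\<^sub>R x) * hermite m (sqrt 2 *\<^sub>R x) * \<omega> (sqrt 2 *\<^sub>R x))"
  define \<Psi> where "\<Psi> w g = (\<Sum>i\<in>?I. \<Gamma> i g * P i ((1 / 2) *\<^sub>R g + w))" for w g
  have \<Gamma>_int: "integrable lborel (\<Gamma> i)" for i
    unfolding \<Gamma>_def using velocity_sphere.integrable_fst[OF gamma_integrable]
    by (cases i) simp
  have P_int: "integrable lborel (P i)" for i
    unfolding P_def using integrable_lborel_scale[OF integrable_hermite_hermite, of "sqrt 2"]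
    by (cases i) simp
  have [measurable]: "\<Gamma> i \<in> borel_measurable borel" "P i \<in> borel_measurable borel" for i
    using borel_measurable_integrable[OF \<Gamma>_int[of i]] borel_measurable_integrable[OF P_int[of i]]
    by simp_all

  (* The spherical integral may be taken term by term as soon as every term is integrable in \<sigma>,
     which absolute convergence of the gamma integrals guarantees for almost every g. *)
  have inner: "(\<integral>\<sigma>. A_integrand e B \<alpha> l k (w + g) w \<sigma> \<partial>sphere_measure) = \<Psi> w g"
    if "\<forall>(n, m)\<in>?I. integrable sphere_measure (gamma_integrand e B (k + l - n) (\<alpha> - m) g)" for w g
  proof -
    have "(\<integral>\<sigma>. A_integrand e B \<alpha> l k (w + g) w \<sigma> \<partial>sphere_measure) =
       (\<integral>\<sigma>. (\<Sum>(n, m)\<in>?I. c n m * gamma_integrand e B (k + l - n) (\<alpha> - m) g \<sigma> * P (n, m) ((1 / 2) *\<^sub>R g + w)) \<partial>sphere_measure)"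
      unfolding A_integrand_expansion c_def P_def by simp
    also have "\<dots> = (\<Sum>(n, m)\<in>?I. (\<integral>\<sigma>. c n m * gamma_integrand e B (k + l - n) (\<alpha> - m) g \<sigma> * P (n, m) ((1 / 2) *\<^sub>R g + w) \<partial>sphere_measure))"
      unfolding case_prod_unfold
      by (intro Bochner_Integration.integral_sum integrable_mult_left integrable_mult_right)
         (use that in auto)
    also have "\<dots> = \<Psi> w g"
      unfolding \<Psi>_def \<Gamma>_def by (simp add: case_prod_unfold)
    finally show ?thesis .
  qed
  have sections: "AE g in lborel. \<forall>(n, m)\<in>?I. integrable sphere_measure (gamma_integrand e B (k + l - n) (\<alpha> - m) g)"
    unfolding AE_finite_all[OF fin] case_prod_unfold
    using velocity_sphere.AE_integrable_fst[OF gamma_integrable] by blast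

  (* The substitution v = w + g, for each fixed w. *)
  have velocity: "(\<integral>v. (\<integral>\<sigma>. A_integrand e B \<alpha> l k v w \<sigma> \<partial>sphere_measure) \<partial>lborel) = (\<integral>g. \<Psi> w g \<partial>lborel)" for w
  proof -
    have "(\<lambda>(v, \<sigma>). A_integrand e B \<alpha> l k v w \<sigma>) \<in> borel_measurable (lborel \<Otimes>\<^sub>M sphere_measure)"
      using measurable_Pair2[OF borel_measurable_integrable[OF A_integrable[of \<alpha> l k]], of w] by simp
    then have "(\<lambda>v. \<integral>\<sigma>. A_integrand e B \<alpha> l k v w \<sigma> \<partial>sphere_measure) \<in> borel_measurable lborel"
      by (rule sphere_measure.borel_measurable_lebesgue_integral)
    moreover have \<Psi>_measurable: "\<Psi> w \<in> borel_measurable borel"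
      unfolding \<Psi>_def by measurable
    moreover have "(\<lambda>v. \<Psi> w (- w + v)) \<in> borel_measurable lborel"
      using measurable_compose[OF _ \<Psi>_measurable, of "\<lambda>v. - w + v" borel] by simp
    moreover have "AE v in lborel. (\<integral>\<sigma>. A_integrand e B \<alpha> l k v w \<sigma> \<partial>sphere_measure) = \<Psi> w (- w + v)"
      using AE_lborel_translation[OF sections, of w]
    proof eventually_elim
      case (elim v)
      then show ?case
        using inner[of "- w + v" w] by simp
    qed
    ultimately have "(\<integral>v. (\<integral>\<sigma>. A_integrand e B \<alpha> l k v w \<sigma> \<partial>sphere_measure) \<partial>lborel) =
        (\<integral>v. \<Psi> w (- w + v) \<partial>lborel)"
      by (intro integral_cong_AE)
    also have "\<dots> = (\<integral>g. \<Psi> w g \<partial>lborel)"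
      by (rule integral_lborel_translation[OF \<Psi>_measurable])
    finally show ?thesis .
  qed

  have "(\<integral>w. (\<integral>v. (\<integral>\<sigma>. A_integrand e B \<alpha> l k v w \<sigma> \<partial>sphere_measure) \<partial>lborel) \<partial>lborel) =
      (\<Sum>i\<in>?I. (\<integral>g. \<Gamma> i g \<partial>lborel) * (\<integral>x. P i x \<partial>lborel))"
    unfolding velocity \<Psi>_def by (rule integral_shear_sum[OF fin \<Gamma>_int P_int])
  (* Orthogonality in the centre of mass; the factor sqrt 2 ^ 3 is the Jacobian of x |-> sqrt 2 x. *)
  also have "\<dots> = (\<Sum>(n, m)\<in>?I. c n m * gamma_coeff e B (k + l - n) (\<alpha> - m)
      * ((if n = m then mi_fact n else 0) / sqrt 2 ^ 3))"
  proof (intro sum.cong refl)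
    fix i assume "i \<in> ?I"
    obtain n m where i: "i = (n, m)" by (cases i)
    have "(\<integral>g. \<Gamma> (n, m) g \<partial>lborel) = c n m * gamma_coeff e B (k + l - n) (\<alpha> - m)"
      by (simp add: \<Gamma>_def gamma_coeff_def)
    moreover have "(\<integral>x. P (n, m) x \<partial>lborel) = (if n = m then mi_fact n else 0) / sqrt 2 ^ 3"
      using integral_lborel_scale[OF integrable_hermite_hermite[of n m], of "sqrt 2"]
      by (simp add: P_def integral_hermite_hermite)
    ultimately show "(\<integral>g. \<Gamma> i g \<partial>lborel) * (\<integral>x. P i x \<partial>lborel) = (case i of (n, m) \<Rightarrow> c n m * gamma_coeff e B (k + l - n) (\<alpha> - m)
      * ((if n = m then mi_fact n else 0) / sqrt 2 ^ 3))"
      unfolding i by simp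
  qed
  also have "\<dots> = (\<Sum>n | n \<le> k + l. \<Sum>m | m \<le> \<alpha>. if n = m then
      c n n * gamma_coeff e B (k + l - n) (\<alpha> - n) * (mi_fact n / sqrt 2 ^ 3) else 0)"
    unfolding sum.cartesian_product[symmetric] by (intro sum.cong refl) simp
  also have "\<dots> = (\<Sum>n | n \<le> k + l. if n \<le> \<alpha> then
      c n n * gamma_coeff e B (k + l - n) (\<alpha> - n) * (mi_fact n / sqrt 2 ^ 3) else 0)"
    by (simp add: sum.delta finite_vec_le)
  also have "\<dots> = (\<Sum>n | n \<le> \<alpha> \<and> n \<le> k + l.
      c n n * gamma_coeff e B (k + l - n) (\<alpha> - n) * (mi_fact n / sqrt 2 ^ 3))"
    by (rule sum.mono_neutral_cong_right) (auto simp: finite_vec_le)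
  finally have integral: "(\<integral>w. (\<integral>v. (\<integral>\<sigma>. A_integrand e B \<alpha> l k v w \<sigma> \<partial>sphere_measure) \<partial>lborel) \<partial>lborel) = \<dots>" .

  have powr: "2 powr ((real (mi_abs \<alpha>) + 3) / 2) = sqrt 2 ^ (mi_abs \<alpha> + 3)"
  proof -
    have "(real (mi_abs \<alpha>) + 3) / 2 = 1 / 2 * real (mi_abs \<alpha> + 3)"
      by simp
    then have "2 powr ((real (mi_abs \<alpha>) + 3) / 2) = (2 powr (1 / 2)) powr real (mi_abs \<alpha> + 3)"
      by (simp only: powr_powr)
    also have "\<dots> = sqrt 2 ^ (mi_abs \<alpha> + 3)"
      by (subst powr_realpow) (simp_all add: powr_half_sqrt)
    finally show ?thesis .
  qed
  show ?thesis
    unfolding A_coeff_def integral powr sum_distrib_left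
  proof (intro sum.cong refl)
    fix n assume "n \<in> {n. n \<le> \<alpha> \<and> n \<le> k + l}"
    then have "mi_choose \<alpha> n * mi_fact n * mi_fact (\<alpha> - n) = mi_fact \<alpha>"
      by (simp add: mi_choose_mi_fact)
    moreover have "mi_fact \<beta> \<noteq> 0" for \<beta>
      by (simp add: mi_fact_def)
    ultimately have "1 / mi_fact \<alpha> * (mi_choose \<alpha> n * mi_fact n) = 1 / mi_fact (\<alpha> - n)"
      by (simp add: divide_simps)
    moreover have "1 / mi_fact \<alpha> * (c n n * gamma_coeff e B (k + l - n) (\<alpha> - n) * (mi_fact n / sqrt 2 ^ 3)) =
       1 / mi_fact \<alpha> * (mi_choose \<alpha> n * mi_fact n) * rotation_coeff l k n
         * gamma_coeff e B (k + l - n) (\<alpha> - n) / (sqrt 2 ^ mi_abs \<alpha> * sqrt 2 ^ 3)"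
      unfolding c_def by (simp only: times_divide_eq_left times_divide_eq_right divide_divide_eq_left mult_ac mult_1)
    ultimately have "1 / mi_fact \<alpha> * (c n n * gamma_coeff e B (k + l - n) (\<alpha> - n) * (mi_fact n / sqrt 2 ^ 3)) =
       1 / mi_fact (\<alpha> - n) * rotation_coeff l k n
         * gamma_coeff e B (k + l - n) (\<alpha> - n) / (sqrt 2 ^ mi_abs \<alpha> * sqrt 2 ^ 3)"
      by simp
    also have "\<dots> = 1 / sqrt 2 ^ (mi_abs \<alpha> + 3) * (1 / mi_fact (\<alpha> - n) * rotation_coeff l k n * gamma_coeff e B (k + l - n) (\<alpha> - n))"
      by (simp only: power_add times_divide_eq_left times_divide_eq_right divide_divide_eq_left mult_ac mult_1)
    finally show "1 / mi_fact \<alpha> * (c n n * gamma_coeff e B (k + l - n) (\<alpha> - n) * (mi_fact n / sqrt 2 ^ 3)) =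
      1 / sqrt 2 ^ (mi_abs \<alpha> + 3) * (let k' = k + l - n; j = \<alpha> - n in
       1 / mi_fact j
         * a_coeff (l $ 1) (k $ 1) (n $ 1) (k' $ 1)
         * a_coeff (l $ 2) (k $ 2) (n $ 2) (k' $ 2)
         * a_coeff (l $ 3) (k $ 3) (n $ 3) (k' $ 3)
         * gamma_coeff e B k' j)"
      unfolding Let_def rotation_coeff_def prod_UNIV_3 by (simp add: mult.assoc)
  qed
qed

end
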